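(* Let $\underline{P}_i$ be a coherent lower prevision on $\mathcal{L}(\mathcal{X}_i)$, with conjugate $\overline{P}_i$, for $i=1,\dots,n$. Let $\Omega=\mathcal{X}_1\times\dots\times\mathcal{X}_n$ carry the total preorder $\preceq$ induced by $Z(x_1,\dots,x_n)=\max_{i=1}^nZ_i(x_i)$, where each $Z_i:\mathcal{X}_i\to[0,1]$ is surjective, and let $\underline{F}_i(z)=\underline{P}_i(Z_i^{-1}([0,z]))$, $\overline{F}_i(z)=\overline{P}_i(Z_i^{-1}([0,z]))$ for $z\in[0,1]$. The p-box $(\underline{F},\overline{F})$ defined by $$\underline{F}(z)=\max\Bigl\{0,1-n+\sum_{i=1}^n\underline{F}_i(z)\Bigr\},\qquad\overline{F}(z)=\min_{i=1}^n\overline{F}_i(z)$$ is the least conservative p-box on $(\Omega,\preceq)$ whose natural extension $\underline{E}_{\underline{F},\overline{F}}$ is dominated by the natural extension $\boxtimes_{i=1}^n\underline{P}_i$ of $\underline{P}_1,\dots,\underline{P}_n$.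
   Context: $\mathcal{L}(\mathcal{X})$ denotes the set of gambles (bounded real functions) on a set $\mathcal{X}$; events are identified with their indicators. A lower prevision on all gambles on a set is coherent if $\underline{P}(f)\ge\inf f$, $\underline{P}(\lambda f)=\lambda\underline{P}(f)$, $\underline{P}(f+g)\ge\underline{P}(f)+\underline{P}(g)$ for all gambles $f,g$ and $\lambda\ge0$; its conjugate upper prevision is $\overline{P}(f)=-\underline{P}(-f)$. A linear prevision is a functional $Q$ on all gambles with $Q(f)\ge\inf f$ and $Q(f+g)=Q(f)+Q(g)$. The natural extension $\boxtimes_{i=1}^n\underline{P}_i$ of the marginals (no assumption on dependence) is the coherent lower prevision on $\mathcal{L}(\Omega)$ that is the lower envelope of all linear previsions $Q$ on $\mathcal{L}(\Omega)$ whose marginals are compatible with the $\underline{P}_i$, i.e. $Q(f\circ\pi_i)\ge\underline{P}_i(f)$ for all $i$ and all $f\in\mathcal{L}(\mathcal{X}_i)$, where $\pi_i:\Omega\to\mathcal{X}_i$ is the projection. It is known (Fréchet bounds) that, for all $A_i\subseteq\mathcal{X}_i$, $\boxtimes_{i}\underline{P}_i(\prod_iA_i)=\max\{0,1-n+\sum_i\underline{P}_i(A_i)\}$ and its conjugate upper prevision satisfies $\boxtimes_i\overline{P}_i(\prod_iA_i)=\min_i\overline{P}_i(A_i)$. The preorder on $\Omega$ is $x\preceq y$ iff $Z(x)\le Z(y)$; $x\prec y$ iff $Z(x)<Z(y)$. $Z$ maps onto $[0,1]$; $0_\Omega$, $1_\Omega$ are elements with $Z$-value $0$ and $1$. $[x,y]=\{v:x\preceq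 v\preceq y\}$, $(x,y]=\{v:x\prec v\preceq y\}$. A cumulative distribution function on $(\Omega,\preceq)$ is a map $F:\Omega\to[0,1]$, non-decreasing with respect to $\preceq$, with $F(1_\Omega)=1$; it is constant on the level sets of $Z$ and is identified with a function of $z=Z(x)\in[0,1]$. A p-box on $(\Omega,\preceq)$ is a pair $(\underline{F},\overline{F})$ of cumulative distribution functions with $\underline{F}\le\overline{F}$. Its natural extension $\underline{E}_{\underline{F},\overline{F}}$ is the pointwise smallest coherent lower prevision $\underline{E}$ on all gambles with $\underline{E}([0_\Omega,x])=\underline{F}(x)$ and $\underline{E}((y,1_\Omega])=1-\overline{F}(y)$ for all $x,y\in\Omega$; equivalently $\underline{E}(f)=\min Q(f)$ over all linear previsions $Q$ on $\mathcal{L}(\Omega)$ with $\underline{F}(z)\le Q(Z^{-1}([0,z]))\le\overline{F}(z)$ for all $z\in[0,1]$. "Dominated by $\underline{P}$" means $\underline{E}_{\underline{F},\overline{F}}(f)\le\underline{P}(f)$ for all gambles $f$ on $\Omega$. "Least conservative" means: the given pair is such a p-box, and every p-box $(\underline{G},\overline{G})$ on $(\Omega,\preceq)$ whose natural extension is dominated by $\underline{P}$ satisfies $\underline{G}\le\underline{F}$ and $\overline{G}\ge\overline{F}$ pointwise. *)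

theory Defs
  imports "HOL-Analysis.Analysis"
begin

text \<open>
  Sets are carriers in an ambient type, and a gamble on \<open>X\<close> is represented by any total function
  that is bounded on \<open>X\<close>. Its values off \<open>X\<close> are irrelevant: infima are taken over \<open>X\<close>, and lemma
  \<open>coherent_lower_prevision_cong\<close> shows that a coherent lower prevision on \<open>X\<close> cannot distinguish
  two representatives of the same gamble.
\<close>

definition gambles :: "'a set \<Rightarrow> ('a \<Rightarrow> real) set" where
  "gambles X = {f. bounded (f ` X)}"

definition coherent_lower_prevision :: "'a set \<Rightarrow> (('a \<Rightarrow> real) \<Rightarrow> real) \<Rightarrow> bool" where
  "coherent_lower_prevision X P \<longleftrightarrow>
     (\<forall>f\<in>gambles X. (INF x\<in>X. f x) \<le> P f) \<and>
     (\<forall>f\<in>gambles X. \<forall>c\<ge>0. P (\<lambda>x. c * f x) = c * P f) \<and>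
     (\<forall>f\<in>gambles X. \<forall>g\<in>gambles X. P f + P g \<le> P (\<lambda>x. f x + g x))"

definition conjugate :: "(('a \<Rightarrow> real) \<Rightarrow> real) \<Rightarrow> ('a \<Rightarrow> real) \<Rightarrow> real" where
  "conjugate P f = - P (\<lambda>x. - f x)"

definition linear_prevision :: "'a set \<Rightarrow> (('a \<Rightarrow> real) \<Rightarrow> real) \<Rightarrow> bool" where
  "linear_prevision X Q \<longleftrightarrow>
     (\<forall>f\<in>gambles X. (INF x\<in>X. f x) \<le> Q f) \<and>
     (\<forall>f\<in>gambles X. \<forall>g\<in>gambles X. Q (\<lambda>x. f x + g x) = Q f + Q g)"

lemma coherent_lower_prevision_cong:
  assumes P: "coherent_lower_prevision X P" and X: "X \<noteq> {}"
    and f: "f \<in> gambles X" and g: "g \<in> gambles X" and eq: "\<And>x. x \<in> X \<Longrightarrow> f x = g x"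
  shows "P f = P g"
proof -
  have *: "P h \<le> P k"
    if h: "h \<in> gambles X" and e: "\<And>x. x \<in> X \<Longrightarrow> h x = k x" for h k
  proof -
    let ?d = "\<lambda>x. k x - h x"
    have im: "?d ` X = {0}" using X e by (auto simp: image_iff)
    then have d: "?d \<in> gambles X" by (simp add: gambles_def)
    have "(INF x\<in>X. ?d x) = 0" unfolding im by simp
    then have "0 \<le> P ?d" using P d unfolding coherent_lower_prevision_def by fastforce
    moreover have "P h + P ?d \<le> P (\<lambda>x. h x + ?d x)"
      using P h d unfolding coherent_lower_prevision_def by blast
    ultimately show ?thesis by simp
  qed
  show ?thesis using *[of f g] *[of g f] f g eq by force
qed

definition marginal_natural_extension ::
    "nat \<Rightarrow> (nat \<Rightarrow> 'a set) \<Rightarrow> (nat \<Rightarrow> ('a \<Rightarrow> real) \<Rightarrow> real) \<Rightarrow> ((nat \<Rightarrow> 'a) \<Rightarrow> real) \<Rightarrow> real" where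
  "marginal_natural_extension n X P f =
     Inf {Q f | Q. linear_prevision (PiE {1..n} X) Q \<and>
                   (\<forall>i\<in>{1..n}. \<forall>g\<in>gambles (X i). P i g \<le> Q (\<lambda>x. g (x i)))}"

definition lower_cdf :: "'a set \<Rightarrow> ('a \<Rightarrow> real) \<Rightarrow> (('a \<Rightarrow> real) \<Rightarrow> real) \<Rightarrow> real \<Rightarrow> real" where
  "lower_cdf X Z P z = P (indicator (Z -` {0..z} \<inter> X))"

definition upper_cdf :: "'a set \<Rightarrow> ('a \<Rightarrow> real) \<Rightarrow> (('a \<Rightarrow> real) \<Rightarrow> real) \<Rightarrow> real \<Rightarrow> real" where
  "upper_cdf X Z P z = conjugate P (indicator (Z -` {0..z} \<inter> X))"

text \<open>
  Below, \<open>\<Omega>\<close> carries the total preorder \<open>Z x \<le> Z y\<close>, where \<open>Z\<close> maps \<open>\<Omega>\<close> onto \<open>[0,1]\<close>. The elements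
  with \<open>Z\<close>-value \<open>0\<close> are its least and those with \<open>Z\<close>-value \<open>1\<close> its greatest elements, so the
  order interval \<open>[0,x]\<close> is \<open>{v \<in> \<Omega>. Z v \<le> Z x}\<close> and \<open>(y,1]\<close> is \<open>{v \<in> \<Omega>. Z y < Z v}\<close>.
\<close>

definition cdf_on :: "'b set \<Rightarrow> ('b \<Rightarrow> real) \<Rightarrow> ('b \<Rightarrow> real) \<Rightarrow> bool" where
  "cdf_on \<Omega> Z F \<longleftrightarrow>
     F ` \<Omega> \<subseteq> {0..1} \<and>
     (\<forall>x\<in>\<Omega>. \<forall>y\<in>\<Omega>. Z x \<le> Z y \<longrightarrow> F x \<le> F y) \<and>
     (\<forall>x\<in>\<Omega>. Z x = 1 \<longrightarrow> F x = 1)"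

definition pbox :: "'b set \<Rightarrow> ('b \<Rightarrow> real) \<Rightarrow> ('b \<Rightarrow> real) \<Rightarrow> ('b \<Rightarrow> real) \<Rightarrow> bool" where
  "pbox \<Omega> Z Fl Fu \<longleftrightarrow> cdf_on \<Omega> Z Fl \<and> cdf_on \<Omega> Z Fu \<and> (\<forall>x\<in>\<Omega>. Fl x \<le> Fu x)"

definition coherent_pbox_extension ::
    "'b set \<Rightarrow> ('b \<Rightarrow> real) \<Rightarrow> ('b \<Rightarrow> real) \<Rightarrow> ('b \<Rightarrow> real) \<Rightarrow> (('b \<Rightarrow> real) \<Rightarrow> real) \<Rightarrow> bool" where
  "coherent_pbox_extension \<Omega> Z Fl Fu E \<longleftrightarrow>
     coherent_lower_prevision \<Omega> E \<and>
     (\<forall>x\<in>\<Omega>. E (indicator {v\<in>\<Omega>. Z v \<le> Z x}) = Fl x) \<and>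
     (\<forall>y\<in>\<Omega>. E (indicator {v\<in>\<Omega>. Z y < Z v}) = 1 - Fu y)"

text \<open>
  The natural extension is a relation rather than a function because it is determined only on
  gambles, not on functions that are unbounded on \<open>\<Omega>\<close>.
\<close>

definition pbox_natural_extension ::
    "'b set \<Rightarrow> ('b \<Rightarrow> real) \<Rightarrow> ('b \<Rightarrow> real) \<Rightarrow> ('b \<Rightarrow> real) \<Rightarrow> (('b \<Rightarrow> real) \<Rightarrow> real) \<Rightarrow> bool" where
  "pbox_natural_extension \<Omega> Z Fl Fu E \<longleftrightarrow>
     coherent_pbox_extension \<Omega> Z Fl Fu E \<and>
     (\<forall>E'. coherent_pbox_extension \<Omega> Z Fl Fu E' \<longrightarrow> (\<forall>f\<in>gambles \<Omega>. E f \<le> E' f))"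

definition pbox_dominated_by ::
    "'b set \<Rightarrow> ('b \<Rightarrow> real) \<Rightarrow> ('b \<Rightarrow> real) \<Rightarrow> ('b \<Rightarrow> real) \<Rightarrow> (('b \<Rightarrow> real) \<Rightarrow> real) \<Rightarrow> bool" where
  "pbox_dominated_by \<Omega> Z Fl Fu P \<longleftrightarrow>
     (\<exists>E. pbox_natural_extension \<Omega> Z Fl Fu E \<and> (\<forall>f\<in>gambles \<Omega>. E f \<le> P f))"

definition least_conservative_pbox ::
    "'b set \<Rightarrow> ('b \<Rightarrow> real) \<Rightarrow> (('b \<Rightarrow> real) \<Rightarrow> real) \<Rightarrow> ('b \<Rightarrow> real) \<Rightarrow> ('b \<Rightarrow> real) \<Rightarrow> bool" where
  "least_conservative_pbox \<Omega> Z P Fl Fu \<longleftrightarrow>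
     pbox \<Omega> Z Fl Fu \<and> pbox_dominated_by \<Omega> Z Fl Fu P \<and>
     (\<forall>Gl Gu. pbox \<Omega> Z Gl Gu \<and> pbox_dominated_by \<Omega> Z Gl Gu P \<longrightarrow>
        (\<forall>x\<in>\<Omega>. Gl x \<le> Fl x \<and> Fu x \<le> Gu x))"

end

theory Submission imports Defs begin

text \<open>
  The natural extension \<open>M\<close> of the marginals is itself a coherent lower prevision, and the claimed
  p-box consists of nothing but its values on the order intervals: \<open>M ([0, x])\<close> is the lower and
  \<open>1 - M ((x, 1])\<close> the upper distribution function. This settles everything at once
  (\<open>least_conservative_of_coherent\<close>). The natural extension of the p-box is the smallest coherent
  lower prevision with these values, and \<open>M\<close> is one of the competitors, so \<open>M\<close> dominates it. If the
  natural extension of another p-box is dominated by \<open>M\<close>, then comparing the two on the intervals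
  themselves shows that the other p-box is at least as wide.

  It remains to see that \<open>M\<close> has these values. Because \<open>Zmax\<close> is a maximum, an interval \<open>[0, x]\<close> is a
  product of sets \<open>A i\<close>, and the values are the Frechet bounds of this product. That these bounds
  hold is elementary; that they are attained is the substance. They are
  attained because \<open>M\<close> has a dual description: \<open>M f\<close> is the supremum of \<open>\<Sum>i. P i (g i)\<close> over all
  marginal gambles with \<open>\<Sum>i. g i (x i) \<le> f x\<close>. The duality is a Hahn-Banach argument, carried out
  for coherent lower previsions in \<open>linear_prevision_above_touching\<close> and used in
  \<open>natext_is_lower_envelope\<close>. On the dual side, it suffices to bound \<open>\<Sum>i. P i (g i)\<close> for an arbitrary
  feasible \<open>g\<close>. Apart from the case that the separable sum is nowhere positive, replacing each \<open>g i\<close> by an affine function of the indicator of \<open>A i\<close> that dominates it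
  reduces this to an inequality between finitely many real numbers (\<open>natext_frechet_lower\<close>,
  \<open>natext_frechet_upper\<close>).
\<close>

section \<open>Gambles and coherent lower previsions\<close>

lemma gambles_iff: "f \<in> gambles X \<longleftrightarrow> (\<exists>B. \<forall>x\<in>X. \<bar>f x\<bar> \<le> B)"
  by (auto simp: gambles_def bounded_iff)

lemma gambles_subset: "f \<in> gambles X \<Longrightarrow> A \<subseteq> X \<Longrightarrow> f \<in> gambles A"
  by (auto simp: gambles_iff)

lemma gambles_const [simp]: "(\<lambda>x. c) \<in> gambles X"
  by (auto simp: gambles_iff)

lemma gambles_indicator [simp]: "indicator A \<in> gambles X"
  by (auto simp: gambles_iff indicator_def intro!: exI[of _ 1])

lemma gambles_of_bool [simp]: "(\<lambda>x. of_bool (R x)) \<in> gambles X"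
  by (auto simp: gambles_iff intro!: exI[of _ 1])

lemma gambles_add [simp]:
  assumes "f \<in> gambles X" "g \<in> gambles X"
  shows "(\<lambda>x. f x + g x) \<in> gambles X"
  using assms unfolding gambles_def by (simp add: bounded_plus_comp)

lemma gambles_diff [simp]:
  assumes "f \<in> gambles X" "g \<in> gambles X"
  shows "(\<lambda>x. f x - g x) \<in> gambles X"
  using assms unfolding gambles_def by (simp add: bounded_minus_comp)

lemma gambles_uminus [simp]: "f \<in> gambles X \<Longrightarrow> (\<lambda>x. - f x) \<in> gambles X"
  by (simp add: gambles_iff)

lemma gambles_scale [simp]:
  assumes "f \<in> gambles X"
  shows "(\<lambda>x. c * f x) \<in> gambles X"
proof -
  obtain B where "\<forall>x\<in>X. \<bar>f x\<bar> \<le> B" using assms by (auto simp: gambles_iff)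
  then have "\<forall>x\<in>X. \<bar>c * f x\<bar> \<le> \<bar>c\<bar> * B" by (simp add: abs_mult mult_left_mono)
  then show ?thesis by (auto simp: gambles_iff)
qed

lemma gambles_sum:
  assumes "finite I" "\<And>i. i \<in> I \<Longrightarrow> f i \<in> gambles X"
  shows "(\<lambda>x. \<Sum>i\<in>I. f i x) \<in> gambles X"
  using assms by (induction I rule: finite_induct) auto

lemma gambles_projection:
  assumes "g \<in> gambles (X i)" "i \<in> I"
  shows "(\<lambda>x. g (x i)) \<in> gambles (PiE I X)"
  using assms by (fastforce simp: gambles_iff)

lemma gamble_INF_lower: "f \<in> gambles X \<Longrightarrow> x \<in> X \<Longrightarrow> (INF x\<in>X. f x) \<le> f x"
  by (rule cINF_lower) (auto simp: gambles_def intro: bounded_imp_bdd_below)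

lemma gamble_SUP_upper: "f \<in> gambles X \<Longrightarrow> x \<in> X \<Longrightarrow> f x \<le> (SUP x\<in>X. f x)"
  by (rule cSUP_upper) (auto simp: gambles_def intro: bounded_imp_bdd_above)

lemma gamble_INF_uminus: "(INF x\<in>X. - f x :: real) = - (SUP x\<in>X. f x)"
  by (simp add: Inf_real_def image_image)

text \<open>
  The two lemmas on superadditive functionals apply to coherent lower previsions and to linear
  previsions alike.
\<close>

lemma superadditive_mono:
  assumes inf: "\<And>f. f \<in> gambles X \<Longrightarrow> (INF x\<in>X. f x) \<le> E f"
    and add: "\<And>f g. f \<in> gambles X \<Longrightarrow> g \<in> gambles X \<Longrightarrow> E f + E g \<le> E (\<lambda>x. f x + g x)"
    and X: "X \<noteq> {}" and f: "f \<in> gambles X" and g: "g \<in> gambles X"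
    and le: "\<And>x. x \<in> X \<Longrightarrow> f x \<le> g x"
  shows "E f \<le> E g"
proof -
  have "0 \<le> (INF x\<in>X. g x - f x)"
    using X le by (intro cINF_greatest) auto
  also have "\<dots> \<le> E (\<lambda>x. g x - f x)" using inf f g by simp
  finally have "E f \<le> E f + E (\<lambda>x. g x - f x)" by simp
  also have "\<dots> \<le> E (\<lambda>x. f x + (g x - f x))" using f g by (intro add) auto
  finally show ?thesis by simp
qed

lemma superadditive_sum:
  assumes inf: "\<And>f. f \<in> gambles X \<Longrightarrow> (INF x\<in>X. f x) \<le> E f"
    and add: "\<And>f g. f \<in> gambles X \<Longrightarrow> g \<in> gambles X \<Longrightarrow> E f + E g \<le> E (\<lambda>x. f x + g x)"
    and X: "X \<noteq> {}" and I: "finite I" "\<And>i. i \<in> I \<Longrightarrow> f i \<in> gambles X"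
  shows "(\<Sum>i\<in>I. E (f i)) \<le> E (\<lambda>x. \<Sum>i\<in>I. f i x)"
  using I
proof (induction I rule: finite_induct)
  case empty
  show ?case using inf[of "\<lambda>x. 0"] X by simp
next
  case (insert j I)
  have "E (f j) + E (\<lambda>x. \<Sum>i\<in>I. f i x) \<le> E (\<lambda>x. f j x + (\<Sum>i\<in>I. f i x))"
    using insert by (intro add gambles_sum) auto
  then show ?case using insert by simp
qed

lemma
  assumes "coherent_lower_prevision X E"
  shows coherent_inf: "f \<in> gambles X \<Longrightarrow> (INF x\<in>X. f x) \<le> E f"
    and coherent_scale: "f \<in> gambles X \<Longrightarrow> 0 \<le> c \<Longrightarrow> E (\<lambda>x. c * f x) = c * E f"
    and coherent_add:
      "f \<in> gambles X \<Longrightarrow> g \<in> gambles X \<Longrightarrow> E f + E g \<le> E (\<lambda>x. f x + g x)"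
  using assms unfolding coherent_lower_prevision_def by blast+

lemma coherent_mono:
  assumes "coherent_lower_prevision X E" "X \<noteq> {}" "f \<in> gambles X" "g \<in> gambles X"
    and "\<And>x. x \<in> X \<Longrightarrow> f x \<le> g x"
  shows "E f \<le> E g"
  using superadditive_mono[where E = E] coherent_inf[OF assms(1)] coherent_add[OF assms(1)]
    assms(2-5) by blast

lemma coherent_zero:
  assumes "coherent_lower_prevision X E"
  shows "E (\<lambda>x. 0) = 0"
  using coherent_scale[OF assms, of "\<lambda>x. 0" 0] by simp

lemma coherent_le_conjugate:
  assumes "coherent_lower_prevision X E" "f \<in> gambles X"
  shows "E f \<le> conjugate E f"
  using coherent_add[OF assms gambles_uminus[OF assms(2)]] coherent_zero[OF assms(1)]
  by (simp add: conjugate_def)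

lemma coherent_conjugate_le_SUP:
  assumes "coherent_lower_prevision X E" "f \<in> gambles X"
  shows "conjugate E f \<le> (SUP x\<in>X. f x)"
  using coherent_inf[OF assms(1) gambles_uminus[OF assms(2)]]
  by (simp add: conjugate_def gamble_INF_uminus)

lemma coherent_le_SUP:
  assumes "coherent_lower_prevision X E" "f \<in> gambles X"
  shows "E f \<le> (SUP x\<in>X. f x)"
  using coherent_le_conjugate[OF assms] coherent_conjugate_le_SUP[OF assms] by simp

lemma coherent_const:
  assumes "coherent_lower_prevision X E" "X \<noteq> {}"
  shows "E (\<lambda>x. c) = c"
  using coherent_inf[OF assms(1), of "\<lambda>x. c"] coherent_le_SUP[OF assms(1), of "\<lambda>x. c"] assms(2)
  by simp

lemma coherent_shift:
  assumes E: "coherent_lower_prevision X E" and X: "X \<noteq> {}" and f: "f \<in> gambles X"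
  shows "E (\<lambda>x. c + f x) = c + E f"
proof (rule antisym)
  show "c + E f \<le> E (\<lambda>x. c + f x)"
    using coherent_add[OF E, of "\<lambda>x. c" f] f coherent_const[OF E X] by simp
  show "E (\<lambda>x. c + f x) \<le> c + E f"
    using coherent_add[OF E, of "\<lambda>x. -c" "\<lambda>x. c + f x"] f coherent_const[OF E X] by simp
qed

text \<open>
  The pattern behind three constructions: \<open>V f\<close> is a set of lower bounds for the price of \<open>f\<close>, coming
  from multiples of a gamble, from a chain of previsions, or from marginal gambles. Since such
  bounds can be scaled and added, their suprema form a coherent lower prevision.
\<close>

lemma coherent_Sup:
  assumes X: "X \<noteq> {}"
    and inf: "\<And>f. f \<in> gambles X \<Longrightarrow> \<exists>a\<in>V f. (INF x\<in>X. f x) \<le> a"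
    and sup: "\<And>f a. f \<in> gambles X \<Longrightarrow> a \<in> V f \<Longrightarrow> a \<le> (SUP x\<in>X. f x)"
    and scale: "\<And>f a c. f \<in> gambles X \<Longrightarrow> a \<in> V f \<Longrightarrow> 0 < c \<Longrightarrow> c * a \<in> V (\<lambda>x. c * f x)"
    and add: "\<And>f g a b. f \<in> gambles X \<Longrightarrow> g \<in> gambles X \<Longrightarrow> a \<in> V f \<Longrightarrow> b \<in> V g \<Longrightarrow>
      \<exists>d\<in>V (\<lambda>x. f x + g x). a + b \<le> d"
  shows "coherent_lower_prevision X (\<lambda>f. Sup (V f))"
proof -
  have ne: "V f \<noteq> {}" if "f \<in> gambles X" for f
    using inf that by blast
  have bdd: "bdd_above (V f)" if "f \<in> gambles X" for f
    using sup that by (intro bdd_aboveI)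
  have inf': "(INF x\<in>X. f x) \<le> Sup (V f)" if "f \<in> gambles X" for f
    using inf[OF that] cSup_upper[OF _ bdd[OF that]] order_trans by blast
  have scale_ge: "c * Sup (V f) \<le> Sup (V (\<lambda>x. c * f x))" if f: "f \<in> gambles X" and c: "0 < c" for f c
  proof -
    have "Sup (V f) \<le> Sup (V (\<lambda>x. c * f x)) / c"
    proof (rule cSup_least[OF ne[OF f]])
      fix a assume "a \<in> V f"
      then have "c * a \<le> Sup (V (\<lambda>x. c * f x))"
        using scale f c bdd by (intro cSup_upper) auto
      then show "a \<le> Sup (V (\<lambda>x. c * f x)) / c" using c by (simp add: field_simps)
    qed
    then show ?thesis using c by (simp add: field_simps)
  qed
  have "Sup (V (\<lambda>x. c * f x)) = c * Sup (V f)" if f: "f \<in> gambles X" and c: "0 \<le> c" for f c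
  proof (cases "c = 0")
    case True
    have "Sup (V (\<lambda>x. 0)) \<le> 0"
      using ne[of "\<lambda>x. 0"] sup[of "\<lambda>x. 0"] X by (intro cSup_least) auto
    moreover have "0 \<le> Sup (V (\<lambda>x. 0))" using inf'[of "\<lambda>x. 0"] X by simp
    ultimately show ?thesis using True by simp
  next
    case False
    then have c: "0 < c" using c by simp
    have "inverse c * Sup (V (\<lambda>x. c * f x)) \<le> Sup (V (\<lambda>x. inverse c * (c * f x)))"
      using c f by (intro scale_ge) auto
    also have "(\<lambda>x. inverse c * (c * f x)) = f" using c by auto
    finally have "Sup (V (\<lambda>x. c * f x)) \<le> c * Sup (V f)" using c by (simp add: field_simps)
    then show ?thesis using scale_ge[OF f c] by simp
  qed
  moreover have "Sup (V f) + Sup (V g) \<le> Sup (V (\<lambda>x. f x + g x))"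
    if f: "f \<in> gambles X" and g: "g \<in> gambles X" for f g
  proof -
    let ?s = "Sup (V (\<lambda>x. f x + g x))"
    have *: "a + b \<le> ?s" if "a \<in> V f" "b \<in> V g" for a b
      using add[OF f g that] cSup_upper[OF _ bdd[OF gambles_add[OF f g]]] order_trans by blast
    have "a \<le> ?s - Sup (V g)" if a: "a \<in> V f" for a
    proof -
      have "b \<le> ?s - a" if "b \<in> V g" for b using *[OF a that] by simp
      then have "Sup (V g) \<le> ?s - a" by (intro cSup_least[OF ne[OF g]])
      then show ?thesis by simp
    qed
    then have "Sup (V f) \<le> ?s - Sup (V g)" by (intro cSup_least[OF ne[OF f]])
    then show ?thesis by simp
  qed
  ultimately show ?thesis using inf' unfolding coherent_lower_prevision_def by blast
qed

section \<open>Linear previsions above a coherent lower prevision\<close>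

text \<open>
  The one-step extension of the Hahn-Banach theorem: buying \<open>h\<close> at its upper price
  \<open>conjugate E h\<close> becomes an acceptable transaction, and \<open>c\<close> is the amount bought. The new prices stay
  below \<open>conjugate E\<close>, hence finite, because \<open>E (f - c h) + E (- f) \<le> c E (- h)\<close>.
\<close>

lemma coherent_raise_to_conjugate:
  assumes E: "coherent_lower_prevision X E" and X: "X \<noteq> {}" and h: "h \<in> gambles X"
  obtains E' where "coherent_lower_prevision X E'" "\<And>f. f \<in> gambles X \<Longrightarrow> E f \<le> E' f"
    "conjugate E h \<le> E' h"
proof -
  let ?u = "conjugate E h"
  define V where "V f = (\<lambda>c. E (\<lambda>x. f x - c * h x) + c * ?u) ` {0..}" for f
  have V_conj: "a \<le> conjugate E f" if f: "f \<in> gambles X" and a: "a \<in> V f" for f a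
  proof -
    obtain c where c: "0 \<le> c" "a = E (\<lambda>x. f x - c * h x) + c * ?u"
      using a by (auto simp: V_def)
    have "E (\<lambda>x. f x - c * h x) + E (\<lambda>x. - f x) \<le> E (\<lambda>x. (f x - c * h x) + - f x)"
      using f h by (intro coherent_add[OF E]) auto
    also have "\<dots> = E (\<lambda>x. c * - h x)" by simp
    also have "\<dots> = c * E (\<lambda>x. - h x)" using h c by (intro coherent_scale[OF E]) auto
    finally show ?thesis using c by (simp add: conjugate_def)
  qed
  have coh: "coherent_lower_prevision X (\<lambda>f. Sup (V f))"
  proof (rule coherent_Sup[OF X])
    fix f assume f: "f \<in> gambles X"
    have "E f \<in> V f" unfolding V_def by (rule image_eqI[of _ _ 0]) auto
    then show "\<exists>a\<in>V f. (INF x\<in>X. f x) \<le> a" using coherent_inf[OF E f] by blast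
  next
    fix f a assume "f \<in> gambles X" "a \<in> V f"
    then show "a \<le> (SUP x\<in>X. f x)"
      using V_conj coherent_conjugate_le_SUP[OF E] by (meson order_trans)
  next
    fix f a and c :: real assume f: "f \<in> gambles X" and a: "a \<in> V f" and c: "0 < c"
    obtain d where d: "0 \<le> d" "a = E (\<lambda>x. f x - d * h x) + d * ?u"
      using a by (auto simp: V_def)
    have "E (\<lambda>x. c * f x - (c * d) * h x) = E (\<lambda>x. c * (f x - d * h x))"
      by (simp add: algebra_simps)
    also have "\<dots> = c * E (\<lambda>x. f x - d * h x)" using f h c by (intro coherent_scale[OF E]) auto
    finally have "c * a = E (\<lambda>x. c * f x - (c * d) * h x) + (c * d) * ?u"
      using d by (simp add: algebra_simps)
    then show "c * a \<in> V (\<lambda>x. c * f x)"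
      unfolding V_def using c d(1) by (intro image_eqI[of _ _ "c * d"]) auto
  next
    fix f g a b assume f: "f \<in> gambles X" and g: "g \<in> gambles X" and "a \<in> V f" "b \<in> V g"
    then obtain c d where c: "0 \<le> c" "a = E (\<lambda>x. f x - c * h x) + c * ?u"
      and d: "0 \<le> d" "b = E (\<lambda>x. g x - d * h x) + d * ?u"
      by (auto simp: V_def)
    have "E (\<lambda>x. f x - c * h x) + E (\<lambda>x. g x - d * h x)
        \<le> E (\<lambda>x. (f x - c * h x) + (g x - d * h x))"
      using f g h by (intro coherent_add[OF E]) auto
    also have "\<dots> = E (\<lambda>x. (f x + g x) - (c + d) * h x)" by (simp add: algebra_simps)
    finally have "a + b \<le> E (\<lambda>x. (f x + g x) - (c + d) * h x) + (c + d) * ?u"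
      using c d by (simp add: algebra_simps)
    moreover have "E (\<lambda>x. (f x + g x) - (c + d) * h x) + (c + d) * ?u \<in> V (\<lambda>x. f x + g x)"
      unfolding V_def using c(1) d(1) by (intro image_eqI[of _ _ "c + d"]) auto
    ultimately show "\<exists>e\<in>V (\<lambda>x. f x + g x). a + b \<le> e" by blast
  qed
  have V_le: "a \<le> Sup (V f)" if "f \<in> gambles X" "a \<in> V f" for f a
    using V_conj that by (intro cSup_upper bdd_aboveI) auto
  show thesis
  proof (rule that[OF coh])
    fix f assume f: "f \<in> gambles X"
    have "E f \<in> V f" unfolding V_def by (rule image_eqI[of _ _ 0]) auto
    then show "E f \<le> Sup (V f)" using V_le f by blast
  next
    have "?u \<in> V h" unfolding V_def
      by (rule image_eqI[of _ _ 1]) (auto simp: coherent_zero[OF E])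
    then show "?u \<le> Sup (V h)" using V_le h by blast
  qed
qed

lemma self_conjugate_linear:
  assumes E: "coherent_lower_prevision X E"
    and conj: "\<And>f. f \<in> gambles X \<Longrightarrow> conjugate E f \<le> E f"
  shows "linear_prevision X E"
proof -
  have "E (\<lambda>x. f x + g x) = E f + E g" if f: "f \<in> gambles X" and g: "g \<in> gambles X" for f g
  proof -
    have "E (\<lambda>x. - f x) + E (\<lambda>x. - g x) \<le> E (\<lambda>x. - (f x + g x))"
      using coherent_add[OF E, of "\<lambda>x. - f x" "\<lambda>x. - g x"] f g by simp
    moreover have "- E (\<lambda>x. - f x) \<le> E f" "- E (\<lambda>x. - g x) \<le> E g"
      using conj f g by (auto simp: conjugate_def)
    moreover have "E (\<lambda>x. f x + g x) \<le> - E (\<lambda>x. - (f x + g x))"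
      using coherent_le_conjugate[OF E gambles_add[OF f g]] by (simp add: conjugate_def)
    ultimately show ?thesis using coherent_add[OF E f g] by linarith
  qed
  then show ?thesis using coherent_inf[OF E] unfolding linear_prevision_def by blast
qed

text \<open>
  By Zorn's lemma there is a maximal coherent lower prevision above \<open>E\<close>. The one-step extension
  cannot increase it, so it is its own conjugate.
\<close>

lemma linear_prevision_above:
  assumes E: "coherent_lower_prevision X E" and X: "X \<noteq> {}"
  obtains Q where "linear_prevision X Q" "\<And>f. f \<in> gambles X \<Longrightarrow> E f \<le> Q f"
proof -
  \<comment> \<open>The value off the gambles is normalised so that the pointwise order is antisymmetric.\<close>
  define norm where "norm F f = (if f \<in> gambles X then F f else 0)"
    for F :: "('a \<Rightarrow> real) \<Rightarrow> real" and f
  define \<A> where "\<A> = {F. coherent_lower_prevision X F \<and> (\<forall>f\<in>gambles X. E f \<le> F f)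
    \<and> (\<forall>f. f \<notin> gambles X \<longrightarrow> F f = 0)}"
  have norm_in: "norm F \<in> \<A>"
    if "coherent_lower_prevision X F" "\<And>f. f \<in> gambles X \<Longrightarrow> E f \<le> F f" for F
    using that by (auto simp: \<A>_def norm_def coherent_lower_prevision_def)
  have "\<exists>M\<in>\<A>. \<forall>F\<in>\<A>. M \<le> F \<longrightarrow> F = M"
  proof (rule predicate_Zorn)
    show "partial_order_on \<A> (relation_of (\<le>) \<A>)"
      by (rule partial_order_on_relation_ofI) auto
  next
    fix C assume C: "C \<in> Chains (relation_of (\<le>) \<A>)"
    then have C_sub: "C \<subseteq> \<A>" by (rule Chains_relation_of)
    have C_coh: "coherent_lower_prevision X F" if "F \<in> C" for F
      using that C_sub by (auto simp: \<A>_def)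
    have total: "F \<le> G \<or> G \<le> F" if "F \<in> C" "G \<in> C" for F G
      using C that by (auto simp: Chains_def relation_of_def)
    show "\<exists>U\<in>\<A>. \<forall>F\<in>C. F \<le> U"
    proof (cases "C = {}")
      case True
      then show ?thesis using norm_in[of E] E by blast
    next
      case False
      then obtain F0 where F0: "F0 \<in> C" by blast
      define V where "V f = (\<lambda>F. F f) ` C" for f
      have coh: "coherent_lower_prevision X (\<lambda>f. Sup (V f))"
      proof (rule coherent_Sup[OF X])
        fix f assume "f \<in> gambles X"
        then show "\<exists>a\<in>V f. (INF x\<in>X. f x) \<le> a"
          using F0 coherent_inf[OF C_coh[OF F0]] by (auto simp: V_def)
      next
        fix f a assume "f \<in> gambles X" "a \<in> V f"
        then show "a \<le> (SUP x\<in>X. f x)" using coherent_le_SUP C_coh by (auto simp: V_def)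
      next
        fix f a and c :: real assume f: "f \<in> gambles X" and a: "a \<in> V f" and c: "0 < c"
        then obtain F where F: "F \<in> C" "a = F f" by (auto simp: V_def)
        then have "c * a = F (\<lambda>x. c * f x)"
          using coherent_scale[OF C_coh[OF F(1)] f, of c] c by simp
        then show "c * a \<in> V (\<lambda>x. c * f x)" using F by (simp add: V_def)
      next
        fix f g a b assume f: "f \<in> gambles X" and g: "g \<in> gambles X" and "a \<in> V f" "b \<in> V g"
        then obtain F G where FG: "F \<in> C" "a = F f" "G \<in> C" "b = G g" by (auto simp: V_def)
        obtain H where H: "H \<in> C" "F \<le> H" "G \<le> H" using total FG by blast
        have "a + b \<le> H f + H g" using FG H by (simp add: le_fun_def add_mono)
        also have "\<dots> \<le> H (\<lambda>x. f x + g x)" using coherent_add[OF C_coh[OF H(1)] f g] .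
        finally show "\<exists>d\<in>V (\<lambda>x. f x + g x). a + b \<le> d" using H by (auto simp: V_def)
      qed
      have upper: "F f \<le> Sup (V f)" if "F \<in> C" "f \<in> gambles X" for F f
        unfolding V_def using that coherent_le_SUP[OF C_coh] by (intro cSUP_upper) (auto intro!: bdd_aboveI)
      have above: "E f \<le> Sup (V f)" if "f \<in> gambles X" for f
        using upper[OF F0 that] F0 C_sub that by (force simp: \<A>_def)
      have "norm (\<lambda>f. Sup (V f)) \<in> \<A>" using norm_in coh above by blast
      moreover have "F \<le> norm (\<lambda>f. Sup (V f))" if "F \<in> C" for F
        using upper that C_sub by (auto simp: le_fun_def norm_def \<A>_def)
      ultimately show ?thesis by blast
    qed
  qed
  then obtain M where M: "M \<in> \<A>" and max: "\<And>F. F \<in> \<A> \<Longrightarrow> M \<le> F \<Longrightarrow> F = M" by blast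
  have coh: "coherent_lower_prevision X M" and above: "\<And>f. f \<in> gambles X \<Longrightarrow> E f \<le> M f"
    and off: "\<And>f. f \<notin> gambles X \<Longrightarrow> M f = 0"
    using M by (auto simp: \<A>_def)
  have "conjugate M h \<le> M h" if h: "h \<in> gambles X" for h
  proof -
    obtain F where F: "coherent_lower_prevision X F" "\<And>f. f \<in> gambles X \<Longrightarrow> M f \<le> F f"
      "conjugate M h \<le> F h"
      using coherent_raise_to_conjugate[OF coh X h] by blast
    have "norm F \<in> \<A>" using F above by (intro norm_in) (auto intro: order_trans)
    moreover have "M \<le> norm F" using F off by (auto simp: le_fun_def norm_def)
    ultimately have "norm F = M" by (rule max)
    then have "M h = F h" using h by (metis norm_def)
    then show ?thesis using F by simp
  qed
  then show thesis using that self_conjugate_linear[OF coh] above by blast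
qed

text \<open>
  Raising \<open>E\<close> at \<open>- f\<close> before extending it bounds the value of the linear prevision at \<open>f\<close> from
  above.
\<close>

lemma linear_prevision_above_touching:
  assumes E: "coherent_lower_prevision X E" and X: "X \<noteq> {}" and f: "f \<in> gambles X"
  obtains Q where "linear_prevision X Q" "\<And>g. g \<in> gambles X \<Longrightarrow> E g \<le> Q g" "Q f \<le> E f"
proof -
  obtain F where F: "coherent_lower_prevision X F" "\<And>g. g \<in> gambles X \<Longrightarrow> E g \<le> F g"
    "conjugate E (\<lambda>x. - f x) \<le> F (\<lambda>x. - f x)"
    using coherent_raise_to_conjugate[OF E X gambles_uminus[OF f]] by blast
  obtain Q where Q: "linear_prevision X Q" "\<And>g. g \<in> gambles X \<Longrightarrow> F g \<le> Q g"
    using linear_prevision_above[OF F(1) X] by blast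
  have add: "Q (\<lambda>x. g x + h x) = Q g + Q h" if "g \<in> gambles X" "h \<in> gambles X" for g h
    using Q(1) that unfolding linear_prevision_def by blast
  have "Q f + Q (\<lambda>x. - f x) = 0"
    using add[OF f gambles_uminus[OF f]] add[of "\<lambda>x. 0" "\<lambda>x. 0"] by simp
  moreover have "- E f \<le> Q (\<lambda>x. - f x)"
    using F(3) Q(2)[OF gambles_uminus[OF f]] by (simp add: conjugate_def)
  ultimately have "Q f \<le> E f" by simp
  then show thesis using that Q F by (meson order_trans)
qed

section \<open>The natural extension of marginals\<close>

text \<open>
  The coordinates of a point of a product can be chosen independently, so a bound on all values of
  a separable sum also bounds the sum of the separate suprema. Induction on \<open>I\<close>: fix the last
  coordinate, take suprema over the others, then over the last one.
\<close>

lemma sum_SUP_le: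
  fixes g :: "'i \<Rightarrow> 'a \<Rightarrow> real"
  assumes "finite I" "\<And>i. i \<in> I \<Longrightarrow> B i \<noteq> {}"
    and "\<And>x. x \<in> PiE I B \<Longrightarrow> (\<Sum>i\<in>I. g i (x i)) \<le> c"
  shows "(\<Sum>i\<in>I. SUP x\<in>B i. g i x) \<le> c"
  using assms
proof (induction I arbitrary: c rule: finite_induct)
  case empty
  then show ?case by simp
next
  case (insert j I)
  let ?S = "\<Sum>i\<in>I. SUP x\<in>B i. g i x"
  have "g j y \<le> c - ?S" if y: "y \<in> B j" for y
  proof -
    have "?S \<le> c - g j y"
    proof (rule insert.IH)
      fix x assume x: "x \<in> PiE I B"
      have "x(j := y) \<in> PiE (insert j I) B" using x y by (auto simp: PiE_def extensional_def)
      then have "(\<Sum>i\<in>insert j I. g i ((x(j := y)) i)) \<le> c" by (rule insert.prems)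
      moreover have "(\<Sum>i\<in>I. g i ((x(j := y)) i)) = (\<Sum>i\<in>I. g i (x i))"
        using insert.hyps by (intro sum.cong) auto
      ultimately show "(\<Sum>i\<in>I. g i (x i)) \<le> c - g j y" using insert.hyps by simp
    qed (use insert.prems in auto)
    then show ?thesis by simp
  qed
  then have "(SUP y\<in>B j. g j y) \<le> c - ?S" using insert.prems by (intro cSUP_least) auto
  then show ?case using insert.hyps by simp
qed

locale coherent_marginals =
  fixes I :: "'i set" and X :: "'i \<Rightarrow> 'a set" and P :: "'i \<Rightarrow> ('a \<Rightarrow> real) \<Rightarrow> real"
  assumes finite_I: "finite I" and I_nonempty: "I \<noteq> {}"
    and X_nonempty: "\<And>i. i \<in> I \<Longrightarrow> X i \<noteq> {}"
    and coherent: "\<And>i. i \<in> I \<Longrightarrow> coherent_lower_prevision (X i) (P i)"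
begin

lemma product_nonempty: "PiE I X \<noteq> {}"
  using X_nonempty by (simp add: PiE_eq_empty_iff)

text \<open>
  The lower bounds for the price of \<open>f\<close> that follow from the marginals alone: a subject who
  buys each \<open>g i\<close> for \<open>P i (g i)\<close> should pay at least the total for any \<open>f\<close> that exceeds their sum. The
  supremum of these bounds is the dual description of the natural extension.
\<close>

definition marginal_bounds :: "(('i \<Rightarrow> 'a) \<Rightarrow> real) \<Rightarrow> real set" where
  "marginal_bounds f = {\<Sum>i\<in>I. P i (g i) | g.
     (\<forall>i\<in>I. g i \<in> gambles (X i)) \<and> (\<forall>x\<in>PiE I X. (\<Sum>i\<in>I. g i (x i)) \<le> f x)}"

lemma marginal_boundsI:
  assumes "\<And>i. i \<in> I \<Longrightarrow> g i \<in> gambles (X i)"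
    and "\<And>x. x \<in> PiE I X \<Longrightarrow> (\<Sum>i\<in>I. g i (x i)) \<le> f x"
  shows "(\<Sum>i\<in>I. P i (g i)) \<in> marginal_bounds f"
  using assms unfolding marginal_bounds_def by blast

lemma marginal_boundsE:
  assumes "a \<in> marginal_bounds f"
  obtains g where "\<And>i. i \<in> I \<Longrightarrow> g i \<in> gambles (X i)"
    "\<And>x. x \<in> PiE I X \<Longrightarrow> (\<Sum>i\<in>I. g i (x i)) \<le> f x" "a = (\<Sum>i\<in>I. P i (g i))"
  using assms unfolding marginal_bounds_def by blast

text \<open>
  The marginals avoid sure loss jointly, whatever the dependence: on a product space, separately
  coherent marginals cannot contradict each other.
\<close>

lemma sum_marginals_le:
  assumes g: "\<And>i. i \<in> I \<Longrightarrow> g i \<in> gambles (X i)"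
    and le: "\<And>x. x \<in> PiE I X \<Longrightarrow> (\<Sum>i\<in>I. g i (x i)) \<le> c"
  shows "(\<Sum>i\<in>I. P i (g i)) \<le> c"
proof -
  have "(\<Sum>i\<in>I. P i (g i)) \<le> (\<Sum>i\<in>I. SUP x\<in>X i. g i x)"
    using coherent_le_SUP[OF coherent] g by (intro sum_mono) auto
  also have "\<dots> \<le> c" using sum_SUP_le[OF finite_I X_nonempty le] .
  finally show ?thesis .
qed

text \<open>The constant \<open>INF f\<close> is spread evenly over the marginals.\<close>

lemma marginal_bounds_inf:
  assumes f: "f \<in> gambles (PiE I X)"
  shows "(INF x\<in>PiE I X. f x) \<in> marginal_bounds f"
proof -
  let ?m = "(INF x\<in>PiE I X. f x)"
  have card: "card I > 0" using finite_I I_nonempty by (simp add: card_gt_0_iff)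
  have "(\<Sum>i\<in>I. P i (\<lambda>x. ?m / card I)) = (\<Sum>i\<in>I. ?m / card I)"
    using coherent_const[OF coherent X_nonempty] by (intro sum.cong) auto
  also have "\<dots> = ?m" using card by simp
  finally have eq: "(\<Sum>i\<in>I. P i (\<lambda>x. ?m / card I)) = ?m" .
  have "(\<Sum>i\<in>I. P i (\<lambda>x. ?m / card I)) \<in> marginal_bounds f"
    using card gamble_INF_lower[OF f] by (intro marginal_boundsI) auto
  then show ?thesis unfolding eq .
qed

definition natext :: "(('i \<Rightarrow> 'a) \<Rightarrow> real) \<Rightarrow> real" where
  "natext f = Sup (marginal_bounds f)"

lemma marginal_bounds_le_SUP:
  assumes "f \<in> gambles (PiE I X)" "a \<in> marginal_bounds f"
  shows "a \<le> (SUP x\<in>PiE I X. f x)"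
proof -
  obtain g where g: "\<And>i. i \<in> I \<Longrightarrow> g i \<in> gambles (X i)"
    "\<And>x. x \<in> PiE I X \<Longrightarrow> (\<Sum>i\<in>I. g i (x i)) \<le> f x" "a = (\<Sum>i\<in>I. P i (g i))"
    using marginal_boundsE[OF assms(2)] by blast
  show ?thesis unfolding g(3)
    using g gamble_SUP_upper[OF assms(1)] by (intro sum_marginals_le) (auto intro: order_trans)
qed

lemma natext_coherent: "coherent_lower_prevision (PiE I X) natext"
  unfolding natext_def[abs_def]
proof (rule coherent_Sup[OF product_nonempty])
  fix f assume "f \<in> gambles (PiE I X)"
  then show "\<exists>a\<in>marginal_bounds f. (INF x\<in>PiE I X. f x) \<le> a" using marginal_bounds_inf by blast
next
  fix f a assume "f \<in> gambles (PiE I X)" "a \<in> marginal_bounds f"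
  then show "a \<le> (SUP x\<in>PiE I X. f x)" by (rule marginal_bounds_le_SUP)
next
  fix f a and c :: real assume a: "a \<in> marginal_bounds f" and c: "0 < c"
  obtain g where g: "\<And>i. i \<in> I \<Longrightarrow> g i \<in> gambles (X i)"
    "\<And>x. x \<in> PiE I X \<Longrightarrow> (\<Sum>i\<in>I. g i (x i)) \<le> f x" "a = (\<Sum>i\<in>I. P i (g i))"
    using marginal_boundsE[OF a] by blast
  have "c * a = (\<Sum>i\<in>I. P i (\<lambda>x. c * g i x))"
    using g c coherent_scale[OF coherent] by (simp add: sum_distrib_left)
  also have "\<dots> \<in> marginal_bounds (\<lambda>x. c * f x)"
    using g c by (intro marginal_boundsI) (auto simp: sum_distrib_left[symmetric])
  finally show "c * a \<in> marginal_bounds (\<lambda>x. c * f x)" .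
next
  fix f f' a b assume a: "a \<in> marginal_bounds f" and b: "b \<in> marginal_bounds f'"
  obtain g where g: "\<And>i. i \<in> I \<Longrightarrow> g i \<in> gambles (X i)"
    "\<And>x. x \<in> PiE I X \<Longrightarrow> (\<Sum>i\<in>I. g i (x i)) \<le> f x" "a = (\<Sum>i\<in>I. P i (g i))"
    using marginal_boundsE[OF a] by blast
  obtain h where h: "\<And>i. i \<in> I \<Longrightarrow> h i \<in> gambles (X i)"
    "\<And>x. x \<in> PiE I X \<Longrightarrow> (\<Sum>i\<in>I. h i (x i)) \<le> f' x" "b = (\<Sum>i\<in>I. P i (h i))"
    using marginal_boundsE[OF b] by blast
  have "(\<Sum>i\<in>I. P i (\<lambda>x. g i x + h i x)) \<in> marginal_bounds (\<lambda>x. f x + f' x)"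
    using g h by (intro marginal_boundsI) (auto simp: sum.distrib add_mono)
  moreover have "a + b \<le> (\<Sum>i\<in>I. P i (\<lambda>x. g i x + h i x))"
    unfolding g(3) h(3) sum.distrib[symmetric]
    using g h coherent_add[OF coherent] by (intro sum_mono) auto
  ultimately show "\<exists>d\<in>marginal_bounds (\<lambda>x. f x + f' x). a + b \<le> d" by blast
qed

lemma natext_upper:
  assumes "f \<in> gambles (PiE I X)" "a \<in> marginal_bounds f"
  shows "a \<le> natext f"
  unfolding natext_def using assms marginal_bounds_le_SUP
  by (intro cSup_upper) (auto intro!: bdd_aboveI)

lemma natext_least:
  assumes "f \<in> gambles (PiE I X)"
    and "\<And>g. (\<And>i. i \<in> I \<Longrightarrow> g i \<in> gambles (X i)) \<Longrightarrow>
      (\<And>x. x \<in> PiE I X \<Longrightarrow> (\<Sum>i\<in>I. g i (x i)) \<le> f x) \<Longrightarrow> (\<Sum>i\<in>I. P i (g i)) \<le> c"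
  shows "natext f \<le> c"
  unfolding natext_def
proof (rule cSup_least)
  show "marginal_bounds f \<noteq> {}" using marginal_bounds_inf[OF assms(1)] by blast
  show "a \<le> c" if "a \<in> marginal_bounds f" for a
    using that assms(2) by (elim marginal_boundsE) auto
qed

lemma natext_marginal:
  assumes j: "j \<in> I" and g: "g \<in> gambles (X j)"
  shows "P j g \<le> natext (\<lambda>x. g (x j))"
proof -
  let ?h = "\<lambda>i x. if i = j then g x else 0"
  have "P j g = (\<Sum>i\<in>I. if i = j then P j g else 0)" using finite_I j by simp
  also have "\<dots> = (\<Sum>i\<in>I. P i (?h i))"
    using coherent_zero[OF coherent] by (intro sum.cong) auto
  also have "\<dots> \<in> marginal_bounds (\<lambda>x. g (x j))"
  proof (rule marginal_boundsI)
    show "?h i \<in> gambles (X i)" for i using g by (cases "i = j") auto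
  qed (use finite_I j in simp)
  finally show ?thesis using g j by (intro natext_upper gambles_projection)
qed

definition compatible :: "((('i \<Rightarrow> 'a) \<Rightarrow> real) \<Rightarrow> real) \<Rightarrow> bool" where
  "compatible Q \<longleftrightarrow> linear_prevision (PiE I X) Q \<and>
     (\<forall>i\<in>I. \<forall>g\<in>gambles (X i). P i g \<le> Q (\<lambda>x. g (x i)))"

lemma natext_le_compatible:
  assumes Q: "compatible Q" and f: "f \<in> gambles (PiE I X)"
  shows "natext f \<le> Q f"
proof (rule natext_least[OF f])
  fix g assume g: "\<And>i. i \<in> I \<Longrightarrow> g i \<in> gambles (X i)"
    and le: "\<And>x. x \<in> PiE I X \<Longrightarrow> (\<Sum>i\<in>I. g i (x i)) \<le> f x"
  have inf: "(INF x\<in>PiE I X. h x) \<le> Q h" if "h \<in> gambles (PiE I X)" for h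
    using Q that unfolding compatible_def linear_prevision_def by blast
  have add: "Q h + Q k \<le> Q (\<lambda>x. h x + k x)"
    if "h \<in> gambles (PiE I X)" "k \<in> gambles (PiE I X)" for h k
    using Q that unfolding compatible_def linear_prevision_def by simp
  have gp: "(\<lambda>x. g i (x i)) \<in> gambles (PiE I X)" if "i \<in> I" for i
    using gambles_projection[where X = X, OF g[OF that] that] .
  have "(\<Sum>i\<in>I. P i (g i)) \<le> (\<Sum>i\<in>I. Q (\<lambda>x. g i (x i)))"
    using Q g unfolding compatible_def by (intro sum_mono) blast
  also have "\<dots> \<le> Q (\<lambda>x. \<Sum>i\<in>I. g i (x i))"
    using superadditive_sum[where E = Q and f = "\<lambda>i x. g i (x i)", OF inf add product_nonempty finite_I gp] .
  also have "\<dots> \<le> Q f"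
    using superadditive_mono[where E = Q, OF inf add product_nonempty _ f le] gambles_sum[OF finite_I gp]
    by simp
  finally show "(\<Sum>i\<in>I. P i (g i)) \<le> Q f" .
qed

text \<open>
  Strong duality. A linear prevision above \<open>natext\<close> is compatible with the marginals by
  \<open>natext_marginal\<close>, and one of them touches \<open>natext\<close> at \<open>f\<close>.
\<close>

lemma natext_is_lower_envelope:
  assumes f: "f \<in> gambles (PiE I X)"
  shows "natext f = Inf {Q f | Q. compatible Q}"
proof (rule antisym)
  obtain Q where Q: "linear_prevision (PiE I X) Q"
    "\<And>g. g \<in> gambles (PiE I X) \<Longrightarrow> natext g \<le> Q g" "Q f \<le> natext f"
    using linear_prevision_above_touching[OF natext_coherent product_nonempty f] by blast
  have "P i g \<le> Q (\<lambda>x. g (x i))" if "i \<in> I" "g \<in> gambles (X i)" for i g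
    using natext_marginal[OF that] Q(2)[OF gambles_projection[where X = X, OF that(2,1)]] by simp
  then have comp: "compatible Q" using Q unfolding compatible_def by blast
  show "natext f \<le> Inf {Q f | Q. compatible Q}"
    using natext_le_compatible[OF _ f] comp by (intro cInf_greatest) auto
  have "Inf {Q f | Q. compatible Q} \<le> Q f"
    using comp natext_le_compatible[OF _ f] by (intro cInf_lower bdd_belowI[of _ "natext f"]) auto
  then show "Inf {Q f | Q. compatible Q} \<le> natext f" using Q by simp
qed

section \<open>Frechet bounds\<close>

lemma indicator_product:
  assumes "x \<in> PiE I X"
  shows "(indicator (PiE I A) x :: real) = (if \<forall>i\<in>I. x i \<in> A i then 1 else 0)"
  using assms by (auto simp: indicator_def PiE_def)

text \<open>
  For the upper estimate let \<open>S\<close> be the sum of the suprema of \<open>g i\<close> over \<open>A i\<close>. If \<open>S \<le> 0\<close>, then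
  \<open>\<Sum>i. g i (x i)\<close> is nowhere positive and the marginal prices sum to at most \<open>0\<close>. If \<open>S > 0\<close>, then each
  \<open>g i\<close> is dominated by \<open>a i\<close> on \<open>A i\<close> and by \<open>a i - S\<close> elsewhere; the prices of these two-valued
  gambles sum to \<open>S\<close> times the second argument of the maximum, and \<open>S \<le> 1\<close>.
\<close>

lemma natext_frechet_lower:
  assumes A: "\<And>i. i \<in> I \<Longrightarrow> A i \<subseteq> X i" "\<And>i. i \<in> I \<Longrightarrow> A i \<noteq> {}"
  shows "natext (indicator (PiE I A))
    = max 0 (1 - real (card I) + (\<Sum>i\<in>I. P i (indicator (A i))))" (is "_ = max 0 ?b")
proof (rule antisym)
  let ?f = "indicator (PiE I A) :: ('i \<Rightarrow> 'a) \<Rightarrow> real"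
  have "0 \<le> natext ?f"
    using coherent_mono[OF natext_coherent product_nonempty, of "\<lambda>x. 0" ?f]
      coherent_zero[OF natext_coherent] by simp
  moreover have "?b \<le> natext ?f"
  proof -
    \<comment> \<open>One minus the number of coordinates of \<open>x\<close> outside their \<open>A i\<close> is at most the indicator of the
      product. The constant term of this sum is spread evenly over \<open>I\<close>.\<close>
    let ?c = "(1 - real (card I)) / card I"
    let ?g = "\<lambda>i x. ?c + indicator (A i) x"
    have card: "card I > 0" using finite_I I_nonempty by (simp add: card_gt_0_iff)
    have "(\<Sum>i\<in>I. P i (?g i)) \<in> marginal_bounds ?f"
    proof (rule marginal_boundsI)
      fix x assume x: "x \<in> PiE I X"
      have sum: "(\<Sum>i\<in>I. ?g i (x i)) = 1 - real (card I) + (\<Sum>i\<in>I. indicator (A i) (x i))"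
        using card by (simp add: sum.distrib)
      show "(\<Sum>i\<in>I. ?g i (x i)) \<le> ?f x"
      proof (cases "\<forall>i\<in>I. x i \<in> A i")
        case True
        then show ?thesis unfolding sum indicator_product[OF x] by simp
      next
        case False
        then obtain j where j: "j \<in> I" "x j \<notin> A j" by blast
        have "(\<Sum>i\<in>I. indicator (A i) (x i) :: real) = (\<Sum>i\<in>I - {j}. indicator (A i) (x i))"
          using finite_I j by (simp add: sum.remove)
        also have "\<dots> \<le> (\<Sum>i\<in>I - {j}. 1)" by (intro sum_mono) (simp add: indicator_def)
        also have "\<dots> = real (card I) - 1"
          using finite_I j card by (simp add: of_nat_diff)
        finally show ?thesis unfolding sum indicator_product[OF x] using False by simp
      qed
    qed simp
    moreover have "(\<Sum>i\<in>I. P i (?g i)) = ?b"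
      using coherent_shift[OF coherent X_nonempty] card by (simp add: sum.distrib)
    ultimately show ?thesis using natext_upper[of ?f] by simp
  qed
  ultimately show "max 0 ?b \<le> natext ?f" by simp
next
  show "natext (indicator (PiE I A)) \<le> max 0 ?b"
  proof (rule natext_least)
    fix g assume g: "\<And>i. i \<in> I \<Longrightarrow> g i \<in> gambles (X i)"
      and le: "\<And>x. x \<in> PiE I X \<Longrightarrow> (\<Sum>i\<in>I. g i (x i)) \<le> indicator (PiE I A) x"
    define a where "a i = (SUP x\<in>A i. g i x)" for i
    define S where "S = (\<Sum>i\<in>I. a i)"
    have PiE_A: "x \<in> PiE I X" if "x \<in> PiE I A" for x using that A by (auto simp: PiE_def)
    have a: "g i x \<le> a i" if "i \<in> I" "x \<in> A i" for i x
      unfolding a_def using gambles_subset[OF g A(1)] that by (intro gamble_SUP_upper) auto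
    have S_le: "S \<le> 1" unfolding S_def a_def
    proof (rule sum_SUP_le[OF finite_I A(2)])
      fix x assume "x \<in> PiE I A"
      then show "(\<Sum>i\<in>I. g i (x i)) \<le> 1" using le[OF PiE_A] by simp
    qed
    show "(\<Sum>i\<in>I. P i (g i)) \<le> max 0 ?b"
    proof (cases "S \<le> 0")
      case True
      have "(\<Sum>i\<in>I. P i (g i)) \<le> 0"
      proof (rule sum_marginals_le[OF g])
        fix x assume x: "x \<in> PiE I X"
        show "(\<Sum>i\<in>I. g i (x i)) \<le> 0"
        proof (cases "\<forall>i\<in>I. x i \<in> A i")
          case True
          then have "(\<Sum>i\<in>I. g i (x i)) \<le> S" unfolding S_def using a by (intro sum_mono) auto
          then show ?thesis using \<open>S \<le> 0\<close> by simp
        next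
          case False
          then show ?thesis using le[OF x] indicator_product[OF x, of A] by (auto split: if_splits)
        qed
      qed
      then show ?thesis by simp
    next
      case False
      \<comment> \<open>With the other coordinates kept inside, leaving \<open>A i\<close> lowers the admissible total to \<open>0\<close>, so
        \<open>y\<close> together with near-optimal other coordinates gives \<open>g i y + (S - a i) \<le> 0\<close>.\<close>
      have off: "g i y \<le> a i - S" if i: "i \<in> I" and y: "y \<in> X i" "y \<notin> A i" for i y
      proof -
        have "(\<Sum>k\<in>I. SUP x\<in>(A(i := {y})) k. g k x) \<le> 0"
        proof (rule sum_SUP_le[OF finite_I])
          fix k assume "k \<in> I" then show "(A(i := {y})) k \<noteq> {}" using A by simp
        next
          fix x assume x: "x \<in> PiE I (A(i := {y}))"
          have xX: "x \<in> PiE I X"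
          proof (rule PiE_I)
            fix k assume "k \<in> I"
            then show "x k \<in> X k" using PiE_mem[OF x, of k] A y by (auto split: if_splits)
          next
            fix k assume "k \<notin> I" then show "x k = undefined" using x by (rule PiE_arb[rotated])
          qed
          have "x i = y" using PiE_mem[OF x i] by simp
          then show "(\<Sum>k\<in>I. g k (x k)) \<le> 0"
            using le[OF xX] indicator_product[OF xX, of A] i y by (auto split: if_splits)
        qed
        also have "(\<Sum>k\<in>I. SUP x\<in>(A(i := {y})) k. g k x)
            = g i y + (\<Sum>k\<in>I - {i}. SUP x\<in>(A(i := {y})) k. g k x)"
          using finite_I i by (simp add: sum.remove)
        also have "(\<Sum>k\<in>I - {i}. SUP x\<in>(A(i := {y})) k. g k x) = (\<Sum>k\<in>I - {i}. a k)"
          by (intro sum.cong) (auto simp: a_def)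
        also have "\<dots> = S - a i" unfolding S_def using finite_I i by (simp add: sum.remove)
        finally show ?thesis by simp
      qed
      have "P i (g i) \<le> (a i - S) + S * P i (indicator (A i))" if i: "i \<in> I" for i
      proof -
        have "P i (g i) \<le> P i (\<lambda>x. (a i - S) + S * indicator (A i) x)"
        proof (rule coherent_mono[OF coherent X_nonempty g])
          show "g i x \<le> (a i - S) + S * indicator (A i) x" if "x \<in> X i" for x
            using off[OF i that] a[OF i] by (auto simp: indicator_def)
        qed (use i in auto)
        also have "\<dots> = (a i - S) + P i (\<lambda>x. S * indicator (A i) x)"
          using i by (intro coherent_shift[OF coherent X_nonempty]) auto
        also have "P i (\<lambda>x. S * indicator (A i) x) = S * P i (indicator (A i))"
          using False i by (intro coherent_scale[OF coherent]) auto
        finally show ?thesis .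
      qed
      then have "(\<Sum>i\<in>I. P i (g i)) \<le> (\<Sum>i\<in>I. (a i - S) + S * P i (indicator (A i)))"
        by (rule sum_mono)
      also have "\<dots> = S * ?b"
        by (simp add: sum.distrib sum_subtractf sum_distrib_left[symmetric] S_def[symmetric] algebra_simps)
      also have "\<dots> \<le> S * max 0 ?b" using False by (intro mult_left_mono) auto
      also have "\<dots> \<le> 1 * max 0 ?b" using S_le by (intro mult_right_mono) auto
      finally show ?thesis by simp
    qed
  qed simp
qed

text \<open>
  Here a feasible \<open>g\<close> has \<open>\<Sum>i. a i \<le> -1\<close> and \<open>\<Sum>i. s i \<le> 0\<close> for the suprema \<open>a i\<close> over \<open>A i\<close> and \<open>s i\<close> over
  \<open>X i\<close>. The price of \<open>g i\<close> is at most the one of the gamble with value \<open>a i\<close> on \<open>A i\<close> and \<open>s i\<close> elsewhere;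
  with the minimal upper probability \<open>u\<close> in place of each \<open>A i\<close>'s own, these prices sum to a convex
  combination of \<open>\<Sum>i. s i\<close> and \<open>\<Sum>i. a i\<close> with weight \<open>u\<close> on the latter.
\<close>

lemma natext_frechet_upper:
  assumes A: "\<And>i. i \<in> I \<Longrightarrow> A i \<subseteq> X i" "\<And>i. i \<in> I \<Longrightarrow> A i \<noteq> {}"
  shows "conjugate natext (indicator (PiE I A)) = (MIN i\<in>I. conjugate (P i) (indicator (A i)))"
    (is "conjugate natext ?f = ?u")
proof -
  have u_le: "?u \<le> conjugate (P i) (indicator (A i))" if "i \<in> I" for i
    using finite_I that by (intro Min_le) auto
  have "conjugate natext ?f \<le> conjugate (P i) (indicator (A i))" if i: "i \<in> I" for i
  proof -
    have "P i (\<lambda>x. - indicator (A i) x) \<le> natext (\<lambda>x. - indicator (A i) (x i))"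
      using i by (intro natext_marginal) auto
    also have "\<dots> \<le> natext (\<lambda>x. - ?f x)"
    proof (rule coherent_mono[OF natext_coherent product_nonempty])
      show "(\<lambda>x. - indicator (A i) (x i)) \<in> gambles (PiE I X)"
        by (auto simp: gambles_iff indicator_def intro!: exI[of _ 1])
      show "- indicator (A i) (x i) \<le> - ?f x" if "x \<in> PiE I X" for x
        using indicator_product[OF that, of A] i by (auto simp: indicator_def)
    qed simp
    finally show ?thesis by (simp add: conjugate_def)
  qed
  then have "conjugate natext ?f \<le> ?u"
    using finite_I I_nonempty by (subst Min_ge_iff) auto
  moreover have "natext (\<lambda>x. - ?f x) \<le> - ?u"
  proof (rule natext_least)
    fix g assume g: "\<And>i. i \<in> I \<Longrightarrow> g i \<in> gambles (X i)"
      and le: "\<And>x. x \<in> PiE I X \<Longrightarrow> (\<Sum>i\<in>I. g i (x i)) \<le> - ?f x"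
    define a where "a i = (SUP x\<in>A i. g i x)" for i
    define s where "s i = (SUP x\<in>X i. g i x)" for i
    have PiE_A: "x \<in> PiE I X" if "x \<in> PiE I A" for x using that A by (auto simp: PiE_def)
    have a: "g i x \<le> a i" if "i \<in> I" "x \<in> A i" for i x
      unfolding a_def using gambles_subset[OF g A(1)] that by (intro gamble_SUP_upper) auto
    have s: "g i x \<le> s i" if "i \<in> I" "x \<in> X i" for i x
      unfolding s_def using g that by (intro gamble_SUP_upper) auto
    have a_le_s: "a i \<le> s i" if "i \<in> I" for i
      unfolding a_def using A[OF that] s[OF that] by (intro cSUP_least) auto
    have sum_a: "(\<Sum>i\<in>I. a i) \<le> - 1" unfolding a_def
    proof (rule sum_SUP_le[OF finite_I A(2)])
      fix x assume "x \<in> PiE I A"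
      then show "(\<Sum>i\<in>I. g i (x i)) \<le> - 1" using le[OF PiE_A] by simp
    qed
    have sum_s: "(\<Sum>i\<in>I. s i) \<le> 0" unfolding s_def
    proof (rule sum_SUP_le[OF finite_I X_nonempty])
      fix x assume x: "x \<in> PiE I X"
      show "(\<Sum>i\<in>I. g i (x i)) \<le> 0" using le[OF x] indicator_pos_le[of "PiE I A" x]
        by (meson neg_le_0_iff_le order_trans)
    qed
    have u_bounds: "0 \<le> ?u" "?u \<le> 1"
    proof -
      have c: "0 \<le> conjugate (P i) (indicator (A i)) \<and> conjugate (P i) (indicator (A i)) \<le> 1"
        if i: "i \<in> I" for i
      proof
        have "P i (\<lambda>x. - indicator (A i) x) \<le> P i (\<lambda>x. 0)"
          using i by (intro coherent_mono[OF coherent X_nonempty]) auto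
        then show "0 \<le> conjugate (P i) (indicator (A i))"
          using coherent_zero[OF coherent[OF i]] by (simp add: conjugate_def)
        have "P i (\<lambda>x. - 1) \<le> P i (\<lambda>x. - indicator (A i) x)"
          using i by (intro coherent_mono[OF coherent X_nonempty]) (auto simp: indicator_def)
        then show "conjugate (P i) (indicator (A i)) \<le> 1"
          using coherent_const[OF coherent[OF i] X_nonempty[OF i]] by (simp add: conjugate_def)
      qed
      show "0 \<le> ?u" using finite_I I_nonempty c by (subst Min_ge_iff) auto
      obtain j where "j \<in> I" using I_nonempty by blast
      then show "?u \<le> 1" using u_le c by (meson order_trans)
    qed
    have "P i (g i) \<le> s i - (s i - a i) * ?u" if i: "i \<in> I" for i
    proof -
      have "P i (g i) \<le> P i (\<lambda>x. s i + (s i - a i) * - indicator (A i) x)"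
      proof (rule coherent_mono[OF coherent X_nonempty g])
        show "g i x \<le> s i + (s i - a i) * - indicator (A i) x" if "x \<in> X i" for x
          using s[OF i that] a[OF i] by (auto simp: indicator_def)
      qed (use i in \<open>auto intro!: gambles_add gambles_scale gambles_uminus simp del: mult_minus_right\<close>)
      also have "\<dots> = s i + P i (\<lambda>x. (s i - a i) * - indicator (A i) x)"
        using i by (intro coherent_shift[OF coherent X_nonempty] gambles_scale gambles_uminus) auto
      also have "P i (\<lambda>x. (s i - a i) * - indicator (A i) x)
          = (s i - a i) * P i (\<lambda>x. - indicator (A i) x)"
        using i a_le_s by (intro coherent_scale[OF coherent]) auto
      also have "s i + (s i - a i) * P i (\<lambda>x. - indicator (A i) x) \<le> s i + (s i - a i) * - ?u"
        using u_le[OF i] a_le_s[OF i]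
        by (intro add_left_mono mult_left_mono) (auto simp: conjugate_def)
      finally show ?thesis by simp
    qed
    then have "(\<Sum>i\<in>I. P i (g i)) \<le> (\<Sum>i\<in>I. s i - (s i - a i) * ?u)" by (rule sum_mono)
    also have "\<dots> = (1 - ?u) * (\<Sum>i\<in>I. s i) + ?u * (\<Sum>i\<in>I. a i)"
      by (simp add: sum.distrib sum_subtractf sum_distrib_right[symmetric] algebra_simps)
    also have "\<dots> \<le> (1 - ?u) * 0 + ?u * - 1"
      using u_bounds sum_s sum_a by (intro add_mono mult_left_mono) auto
    finally show "(\<Sum>i\<in>I. P i (g i)) \<le> - ?u" by simp
  qed simp
  then have "?u \<le> conjugate natext ?f" by (simp add: conjugate_def)
  ultimately show ?thesis by simp
qed

end

section \<open>P-boxes of coherent lower previsions\<close>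

text \<open>
  Monotonicity, normalisation and \<open>Fl \<le> Fu\<close> are inherited from any coherent lower prevision with the
  prescribed values: they are its monotonicity on nested intervals, its values at \<open>\<Omega>\<close> and \<open>{}\<close>, and its
  superadditivity on complementary intervals.
\<close>

lemma pbox_of_coherent:
  assumes E: "coherent_pbox_extension \<Omega> Z Fl Fu E" and ne: "\<Omega> \<noteq> {}"
    and Z: "\<And>x. x \<in> \<Omega> \<Longrightarrow> Z x \<le> 1"
  shows "pbox \<Omega> Z Fl Fu"
proof -
  let ?D = "\<lambda>x. {v\<in>\<Omega>. Z v \<le> Z x}" and ?U = "\<lambda>x. {v\<in>\<Omega>. Z x < Z v}"
  have coh: "coherent_lower_prevision \<Omega> E"
    and Fl: "\<And>x. x \<in> \<Omega> \<Longrightarrow> E (indicator (?D x)) = Fl x"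
    and Fu: "\<And>x. x \<in> \<Omega> \<Longrightarrow> E (indicator (?U x)) = 1 - Fu x"
    using E unfolding coherent_pbox_extension_def by auto
  have mono: "E (indicator A) \<le> E (indicator B)" if "A \<subseteq> B" for A B
    using that by (intro coherent_mono[OF coh ne]) (auto simp: indicator_def)
  have ge0: "0 \<le> E (indicator A)" for A
    using mono[of "{}" A] coherent_zero[OF coh] by (simp add: indicator_def[abs_def])
  have le1: "E (indicator A) \<le> 1" for A
    using mono[of A UNIV] coherent_const[OF coh ne, of 1] by (simp add: indicator_def[abs_def])
  have top: "E (indicator \<Omega>) = 1"
  proof -
    have "E (\<lambda>x. 1) \<le> E (indicator \<Omega>)" by (intro coherent_mono[OF coh ne]) auto
    then show ?thesis using le1[of \<Omega>] coherent_const[OF coh ne] by simp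
  qed
  have D1: "?D x = \<Omega>" and U1: "?U x = {}" if "Z x = 1" for x
    using Z that by fastforce+
  have le: "Fl x \<le> Fu x" if x: "x \<in> \<Omega>" for x
  proof -
    have "Fl x + (1 - Fu x) \<le> E (\<lambda>v. indicator (?D x) v + indicator (?U x) v)"
      using coherent_add[OF coh, of "indicator (?D x)" "indicator (?U x)"] Fl[OF x] Fu[OF x] by simp
    also have "\<dots> \<le> E (\<lambda>v. 1)"
      by (rule coherent_mono[OF coh ne gambles_add[OF gambles_indicator gambles_indicator]
            gambles_const]) (auto simp: indicator_def)
    finally show ?thesis using coherent_const[OF coh ne] by simp
  qed
  have "cdf_on \<Omega> Z Fl" unfolding cdf_on_def
  proof (intro conjI ballI impI)
    show "Fl ` \<Omega> \<subseteq> {0..1}" using ge0 le1 Fl by (auto simp: Fl[symmetric])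
    show "Fl x \<le> Fl y" if "x \<in> \<Omega>" "y \<in> \<Omega>" "Z x \<le> Z y" for x y
    proof -
      have "?D x \<subseteq> ?D y" using that by auto
      then show ?thesis using mono[of "?D x" "?D y"] Fl that by simp
    qed
    show "Fl x = 1" if "x \<in> \<Omega>" "Z x = 1" for x
      using Fl[OF that(1)] D1[OF that(2)] top by simp
  qed
  moreover have "cdf_on \<Omega> Z Fu" unfolding cdf_on_def
  proof (intro conjI ballI impI)
    show "Fu ` \<Omega> \<subseteq> {0..1}"
    proof (intro image_subsetI)
      fix x assume "x \<in> \<Omega>"
      then show "Fu x \<in> {0..1}" using ge0[of "?U x"] le1[of "?U x"] Fu by simp
    qed
    show "Fu x \<le> Fu y" if "x \<in> \<Omega>" "y \<in> \<Omega>" "Z x \<le> Z y" for x y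
    proof -
      have "?U y \<subseteq> ?U x" using that by auto
      then show ?thesis using mono[of "?U y" "?U x"] Fu that by simp
    qed
    show "Fu x = 1" if "x \<in> \<Omega>" "Z x = 1" for x
      using Fu[OF that(1)] U1[OF that(2)] coherent_zero[OF coh] by (simp add: indicator_def[abs_def])
  qed
  ultimately show ?thesis using le unfolding pbox_def by blast
qed

lemma coherent_Inf:
  assumes ne: "\<E> \<noteq> {}" and coh: "\<And>E. E \<in> \<E> \<Longrightarrow> coherent_lower_prevision X E"
  shows "coherent_lower_prevision X (\<lambda>f. INF E\<in>\<E>. E f)"
proof -
  have lower: "(INF E\<in>\<E>. E f) \<le> E f" if "f \<in> gambles X" "E \<in> \<E>" for f E
    using that coherent_inf[OF coh] by (intro cINF_lower bdd_belowI2) auto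
  have "(INF E\<in>\<E>. E (\<lambda>x. c * f x)) = c * (INF E\<in>\<E>. E f)" if f: "f \<in> gambles X" and c: "0 \<le> c" for f c
  proof -
    have "(INF E\<in>\<E>. E (\<lambda>x. c * f x)) = (INF E\<in>\<E>. c * E f)"
      using coherent_scale[OF coh f c] by (intro INF_cong) auto
    also have "\<dots> = c * (INF E\<in>\<E>. E f)"
    proof (cases "c = 0")
      case True then show ?thesis using ne by simp
    next
      case False
      then have c: "0 < c" using c by simp
      have "bdd_below ((\<lambda>E. c * E f) ` \<E>)"
        using f lower c by (intro bdd_belowI2[of _ "c * (INF E\<in>\<E>. E f)"] mult_left_mono) auto
      then have low: "(INF E\<in>\<E>. c * E f) \<le> c * E f" if "E \<in> \<E>" for E
        using that by (intro cINF_lower)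
      have "(INF E\<in>\<E>. c * E f) / c \<le> (INF E\<in>\<E>. E f)"
        using ne low c by (intro cINF_greatest) (auto simp: field_simps)
      moreover have "c * (INF E\<in>\<E>. E f) \<le> (INF E\<in>\<E>. c * E f)"
        using ne lower f c by (intro cINF_greatest mult_left_mono) auto
      ultimately show ?thesis using c by (simp add: field_simps)
    qed
    finally show ?thesis .
  qed
  moreover have "(INF x\<in>X. f x) \<le> (INF E\<in>\<E>. E f)" if "f \<in> gambles X" for f
    using ne coherent_inf[OF coh that] by (intro cINF_greatest)
  moreover have "(INF E\<in>\<E>. E f) + (INF E\<in>\<E>. E g) \<le> (INF E\<in>\<E>. E (\<lambda>x. f x + g x))"
    if f: "f \<in> gambles X" and g: "g \<in> gambles X" for f g
  proof (rule cINF_greatest[OF ne])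
    fix E assume "E \<in> \<E>"
    then show "(INF E\<in>\<E>. E f) + (INF E\<in>\<E>. E g) \<le> E (\<lambda>x. f x + g x)"
      using coherent_add[OF coh f g] lower[OF f] lower[OF g] by fastforce
  qed
  ultimately show ?thesis unfolding coherent_lower_prevision_def by blast
qed

text \<open>
  The infimum of all coherent extensions is again one, as they share the prescribed values.
\<close>

lemma pbox_natural_extension_exists:
  assumes E: "coherent_pbox_extension \<Omega> Z Fl Fu E"
  obtains E' where "pbox_natural_extension \<Omega> Z Fl Fu E'"
proof -
  let ?\<E> = "{E. coherent_pbox_extension \<Omega> Z Fl Fu E}"
  define L where "L f = (INF E\<in>?\<E>. E f)" for f
  have ne: "?\<E> \<noteq> {}" using E by blast
  have coh: "coherent_lower_prevision \<Omega> E" if "E \<in> ?\<E>" for E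
    using that by (simp add: coherent_pbox_extension_def)
  have const: "L f = c" if "\<And>E. E \<in> ?\<E> \<Longrightarrow> E f = c" for f c
  proof -
    have "L f = (INF E\<in>?\<E>. c)" unfolding L_def using that by (intro INF_cong) auto
    then show ?thesis using ne by simp
  qed
  have "coherent_pbox_extension \<Omega> Z Fl Fu L"
    unfolding coherent_pbox_extension_def
  proof (intro conjI ballI)
    show "coherent_lower_prevision \<Omega> L"
      unfolding L_def[abs_def] using ne coh by (rule coherent_Inf)
    show "L (indicator {v\<in>\<Omega>. Z v \<le> Z x}) = Fl x" if "x \<in> \<Omega>" for x
      using that by (intro const) (simp add: coherent_pbox_extension_def)
    show "L (indicator {v\<in>\<Omega>. Z y < Z v}) = 1 - Fu y" if "y \<in> \<Omega>" for y
      using that by (intro const) (simp add: coherent_pbox_extension_def)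
  qed
  moreover have "L f \<le> E' f" if "E' \<in> ?\<E>" "f \<in> gambles \<Omega>" for E' f
    unfolding L_def using that coherent_inf[OF coh] by (intro cINF_lower bdd_belowI2) auto
  ultimately show thesis using that[of L] unfolding pbox_natural_extension_def by simp
qed

text \<open>
  A coherent lower prevision is its own witness: it competes in the definition of the natural
  extension of the p-box formed by its values on order intervals, and any p-box whose extension it
  dominates can be compared with it on these intervals.
\<close>

lemma least_conservative_of_coherent:
  assumes P: "coherent_pbox_extension \<Omega> Z Fl Fu P" and ne: "\<Omega> \<noteq> {}"
    and Z: "\<And>x. x \<in> \<Omega> \<Longrightarrow> Z x \<le> 1"
  shows "least_conservative_pbox \<Omega> Z P Fl Fu"
  unfolding least_conservative_pbox_def
proof (intro conjI allI impI ballI)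
  show "pbox \<Omega> Z Fl Fu" using pbox_of_coherent[OF assms] .
  show "pbox_dominated_by \<Omega> Z Fl Fu P"
    using pbox_natural_extension_exists[OF P] P
    unfolding pbox_dominated_by_def pbox_natural_extension_def by metis
next
  fix Gl Gu x assume G: "pbox \<Omega> Z Gl Gu \<and> pbox_dominated_by \<Omega> Z Gl Gu P" and x: "x \<in> \<Omega>"
  then obtain E where E: "coherent_pbox_extension \<Omega> Z Gl Gu E" "\<And>f. f \<in> gambles \<Omega> \<Longrightarrow> E f \<le> P f"
    unfolding pbox_dominated_by_def pbox_natural_extension_def by blast
  show "Gl x \<le> Fl x"
    using E(2)[of "indicator {v\<in>\<Omega>. Z v \<le> Z x}"] E(1) P x
    by (simp add: coherent_pbox_extension_def)
  show "Fu x \<le> Gu x"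
    using E(2)[of "indicator {v\<in>\<Omega>. Z x < Z v}"] E(1) P x
    by (simp add: coherent_pbox_extension_def)
qed

theorem theorem23:
  fixes n :: nat
    and X :: "nat \<Rightarrow> 'a set"
    and P :: "nat \<Rightarrow> ('a \<Rightarrow> real) \<Rightarrow> real"
    and Z :: "nat \<Rightarrow> 'a \<Rightarrow> real"
    and Zmax :: "(nat \<Rightarrow> 'a) \<Rightarrow> real"
  assumes "1 \<le> n"
    and "\<And>i. i \<in> {1..n} \<Longrightarrow> coherent_lower_prevision (X i) (P i)"
    and "\<And>i. i \<in> {1..n} \<Longrightarrow> Z i ` X i = {0..1}"
    and "\<And>x. Zmax x = (MAX i\<in>{1..n}. Z i (x i))"
  shows "least_conservative_pbox (PiE {1..n} X) Zmax (marginal_natural_extension n X P)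
           (\<lambda>x. max 0 (1 - real n + (\<Sum>i=1..n. lower_cdf (X i) (Z i) (P i) (Zmax x))))
           (\<lambda>x. MIN i\<in>{1..n}. upper_cdf (X i) (Z i) (P i) (Zmax x))"
proof -
  let ?\<Omega> = "PiE {1..n} X" and ?M = "marginal_natural_extension n X P"
  have Z01: "0 \<le> Z i y" "Z i y \<le> 1" if "i \<in> {1..n}" "y \<in> X i" for i y
    using assms(3)[OF that(1)] that(2) by (metis atLeastAtMost_iff imageI)+
  have XN: "X i \<noteq> {}" if "i \<in> {1..n}" for i using assms(3)[OF that] by auto
  interpret coherent_marginals "{1..n}" X P
    using assms(1,2) XN by unfold_locales auto
  have M: "?M f = natext f" if "f \<in> gambles ?\<Omega>" for f
    unfolding natext_is_lower_envelope[OF that] marginal_natural_extension_def compatible_def by simp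
  have M_coherent: "coherent_lower_prevision ?\<Omega> ?M"
    using natext_coherent M by (simp add: coherent_lower_prevision_def)
  have Zmax_le: "Zmax x \<le> z \<longleftrightarrow> (\<forall>i\<in>{1..n}. Z i (x i) \<le> z)" for x z
    unfolding assms(4) using assms(1) by (subst Max_le_iff) auto
  have Zmax01: "0 \<le> Zmax x" "Zmax x \<le> 1" if "x \<in> ?\<Omega>" for x
  proof -
    show "Zmax x \<le> 1" unfolding Zmax_le using Z01(2) PiE_mem[OF that] by blast
    have "Z 1 (x 1) \<le> Zmax x" unfolding assms(4) using assms(1) by (intro Max_ge) auto
    moreover have "0 \<le> Z 1 (x 1)" using assms(1) that by (intro Z01) auto
    ultimately show "0 \<le> Zmax x" by simp
  qed
  define A where "A z i = Z i -` {0..z} \<inter> X i" for z i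
  have A_sub: "A z i \<subseteq> X i" for z i by (auto simp: A_def)
  have A_ne: "A z i \<noteq> {}" if "i \<in> {1..n}" "0 \<le> z" for z i
  proof -
    have "0 \<in> Z i ` X i" using assms(3)[OF that(1)] by simp
    then obtain y where "y \<in> X i" "Z i y = 0" by auto
    then have "y \<in> A z i" using that(2) by (simp add: A_def)
    then show ?thesis by blast
  qed
  have down: "{v\<in>?\<Omega>. Zmax v \<le> z} = PiE {1..n} (A z)" for z
  proof -
    have mem: "v i \<in> A z i \<longleftrightarrow> Z i (v i) \<le> z" if "v \<in> ?\<Omega>" "i \<in> {1..n}" for v i
      using Z01(1)[OF that(2) PiE_mem[OF that]] PiE_mem[OF that] by (simp add: A_def)
    show ?thesis
    proof (intro set_eqI iffI)
      fix v assume "v \<in> {v\<in>?\<Omega>. Zmax v \<le> z}"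
      then have v: "v \<in> ?\<Omega>" and le: "\<And>i. i \<in> {1..n} \<Longrightarrow> Z i (v i) \<le> z"
        unfolding Zmax_le by blast+
      show "v \<in> PiE {1..n} (A z)"
        using mem[OF v] le PiE_arb[OF v] by (intro PiE_I) blast+
    next
      fix v assume v: "v \<in> PiE {1..n} (A z)"
      then have "v \<in> ?\<Omega>" using PiE_mono[of "{1..n}" "A z" X] A_sub by blast
      then show "v \<in> {v\<in>?\<Omega>. Zmax v \<le> z}"
        unfolding Zmax_le using mem PiE_mem[OF v] by blast
    qed
  qed
  have lower: "natext (indicator {v\<in>?\<Omega>. Zmax v \<le> Zmax x})
      = max 0 (1 - real n + (\<Sum>i=1..n. lower_cdf (X i) (Z i) (P i) (Zmax x)))"
    if x: "x \<in> ?\<Omega>" for x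
    unfolding down lower_cdf_def A_def[symmetric]
    using natext_frechet_lower[OF A_sub A_ne[OF _ Zmax01(1)[OF x]]] by simp
  have upper: "natext (indicator {v\<in>?\<Omega>. Zmax x < Zmax v})
      = 1 - (MIN i\<in>{1..n}. upper_cdf (X i) (Z i) (P i) (Zmax x))"
    if x: "x \<in> ?\<Omega>" for x
  proof -
    let ?D = "{v\<in>?\<Omega>. Zmax v \<le> Zmax x}"
    have "natext (indicator {v\<in>?\<Omega>. Zmax x < Zmax v}) = natext (\<lambda>v. 1 + - indicator ?D v)"
      by (rule coherent_lower_prevision_cong[OF natext_coherent product_nonempty])
        (auto simp: indicator_def gambles_iff intro: exI[of _ 1])
    also have "\<dots> = 1 - conjugate natext (indicator ?D)"
      using coherent_shift[OF natext_coherent product_nonempty, of "\<lambda>v. - indicator ?D v"]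
      by (simp add: conjugate_def)
    also have "conjugate natext (indicator ?D)
        = (MIN i\<in>{1..n}. upper_cdf (X i) (Z i) (P i) (Zmax x))"
      unfolding down upper_cdf_def A_def[symmetric]
      by (rule natext_frechet_upper[OF A_sub A_ne[OF _ Zmax01(1)[OF x]]])
    finally show ?thesis .
  qed
  have "coherent_pbox_extension ?\<Omega> Zmax
      (\<lambda>x. max 0 (1 - real n + (\<Sum>i=1..n. lower_cdf (X i) (Z i) (P i) (Zmax x))))
      (\<lambda>x. MIN i\<in>{1..n}. upper_cdf (X i) (Z i) (P i) (Zmax x)) ?M"
    unfolding coherent_pbox_extension_def using M_coherent M lower upper by simp
  then show ?thesis using product_nonempty Zmax01 by (intro least_conservative_of_coherent)
qed

end
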